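(* Assume that $f$ is $\sigma$-strongly convex and $\beta$-smooth with $0<\sigma\le\beta$, let $\gamma>0$, $m:=1+\gamma\sigma$, $L:=1+\gamma\beta$, $\theta_G:=\frac{L-m}{L+m}$ and $\theta:=\max\{\theta_Q,\theta_G^b\}$. Let $p_k=P_{\gamma f}z_k$. One call of the certified inner routine (steps 1–5 of the algorithm described in the context, which produces $x_k$ from $a_{k-1}$ and $z_k$) satisfies $$\|x_k-p_k\|\le\theta\,\|a_{k-1}-p_k\| .$$
   Context: Setting and notation. $\mathcal H$ is a finite-dimensional real Hilbert space, $f:\mathcal H\to\mathbb R$ is convex and twice continuously differentiable; $\beta$-smooth means $\nabla f$ is $\beta$-Lipschitz. $P_{\gamma f}u:=\arg\min_x\{\gamma f(x)+\frac12\|x-u\|^2\}$. For a center $z_k$ put $\phi_k(x):=\gamma f(x)+\frac12\|x-z_k\|^2$ and $r_k(x):=\nabla\phi_k(x)=\gamma\nabla f(x)+x-z_k$. For vectors $a,b$, $ab^\top$ is the operator $h\mapsto\langle b,h\rangle a$. Certified inner routine. Parameters: integers $K\ge0$ and $b\ge1$, $c_A\in(0,1/2)$, $\theta_Q\in(0,1)$, $\nu_{\rm qn}\in(0,2)$, $\bar\eta\in(0,1]$, $\epsilon_{\rm sr1}\in(0,1)$, $0<\underline h\le\overline h<\infty$, $\vartheta_0\in[\underline h,\overline h]$, and an update type (BFGS or SR1). Given: a center $z_k\in\mathcal H$, an anchor $a_{k-1}\in\mathcal H$, and an ordered memory $\mathcal M_k$ of accepted exact secant pairs, i.e. pairs $(s,q)$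 with $s=v-u$, $q=\gamma(\nabla f(v)-\nabla f(u))+s$, $s\neq 0$. 1. Set $\bar r_k:=r_k(a_{k-1})=\gamma\nabla f(a_{k-1})+a_{k-1}-z_k$. 2. Build self-adjoint positive definite $H_k$ and $B_k=H_k^{-1}$: start from $H=\vartheta_kI$, $B=\vartheta_k^{-1}I$, where $\vartheta_k=\min\{\overline h,\max\{\underline h,\langle s_\ell,q_\ell\rangle/\|q_\ell\|^2\}\}$ with $(s_\ell,q_\ell)$ the newest pair of $\mathcal M_k$ (and $\vartheta_k=\vartheta_0$ if $\mathcal M_k=\emptyset$); then process the pairs $(s,y)$ of $\mathcal M_k$ in chronological order. BFGS: with $\omega=1/\langle s,y\rangle$ and $V=I-\omega sy^\top$, $H^+=VHV^\top+\omega ss^\top$, $B^+=B-\frac{Bss^\top B}{\langle s,Bs\rangle}+\frac{yy^\top}{\langle s,y\rangle}$. Safeguarded SR1: with $u=s-Hy$, $v=y-Bs$ and nonzero denominators, $H^+=H+\frac{uu^\top}{\langle u,y\rangle}$, $B^+=B+\frac{vv^\top}{\langle v,s\rangle}$, performed only if $|\langle u,y\rangle|\ge\epsilon_{\rm sr1}\|u\|\|y\|$, $\underline hI\preceq H^+\preceq\overline hI$ and $\overline h^{-1}I\preceq B^+\preceq\underline h^{-1}I$; otherwise the pair is skipped. 3. Predictor: $\widetilde x_{k,0}=a_{k-1}$, $\widetilde r_{k,0}=\bar r_k$. For $j=0,\dots,K-1$: $d_{k,j}=-H_k\widetilde r_{k,j}$; $\eta_{k,j}=\min\{\bar\eta,\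 \nu_{\rm qn}\frac{-\langle\widetilde r_{k,j},d_{k,j}\rangle}{\langle d_{k,j},B_kd_{k,j}\rangle}\}$ if $d_{k,j}\ne0$, $\langle\widetilde r_{k,j},d_{k,j}\rangle<0$ and $\langle d_{k,j},B_kd_{k,j}\rangle>0$, and $\eta_{k,j}=0$ otherwise (then all later pseudo-states equal the current one); $\widetilde x_{k,j+1}=\widetilde x_{k,j}+\eta_{k,j}d_{k,j}$; $\widetilde r_{k,j+1}=\widetilde r_{k,j}+B_k(\widetilde x_{k,j+1}-\widetilde x_{k,j})$. Candidate: $\widehat x_k=\widetilde x_{k,K}$ ($=a_{k-1}$ if $K=0$). 4. Accept, $x_k:=\widehat x_k$, if all three tests hold: $\langle\bar r_k,\widehat x_k-a_{k-1}\rangle<0$; $\phi_k(\widehat x_k)\le\phi_k(a_{k-1})+c_A\langle\bar r_k,\widehat x_k-a_{k-1}\rangle$; $\|r_k(\widehat x_k)\|\le\frac mL\theta_Q\|\bar r_k\|$. 5. Otherwise set $u_0=a_{k-1}$, $u_{j+1}=u_j-\tau_Gr_k(u_j)$ with $\tau_G=\frac{2}{m+L}$ for $j=0,\dots,b-1$, and $x_k:=u_b$. *)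

theory Defs
  imports "HOL-Analysis.Analysis"
begin

definition grad :: "('a::euclidean_space \<Rightarrow> real) \<Rightarrow> 'a \<Rightarrow> 'a" where
  "grad f x = (THE D. GDERIV f x :> D)"

lemma grad_eqI:
  assumes "GDERIV f x :> D"
  shows "grad f x = D"
  unfolding grad_def
proof (rule the_equality)
  show "GDERIV f x :> D" by (rule assms)
next
  fix E assume "GDERIV f x :> E"
  then have "(\<lambda>h. h \<bullet> E) = (\<lambda>h. h \<bullet> D)"
    using assms unfolding gderiv_def by (rule has_derivative_unique)
  then have "\<forall>h. h \<bullet> E = h \<bullet> D" by (simp add: fun_eq_iff)
  then show "E = D" by (metis vector_eq_rdot inner_commute)
qed

definition twice_continuously_differentiable :: "('a::euclidean_space \<Rightarrow> real) \<Rightarrow> bool" where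
  "twice_continuously_differentiable f \<longleftrightarrow>
    (\<exists>(f' :: 'a \<Rightarrow> 'a \<Rightarrow>\<^sub>L real) (f'' :: 'a \<Rightarrow> 'a \<Rightarrow>\<^sub>L ('a \<Rightarrow>\<^sub>L real)).
       (\<forall>x. (f has_derivative blinfun_apply (f' x)) (at x)) \<and>
       (\<forall>x. (f' has_derivative blinfun_apply (f'' x)) (at x)) \<and>
       continuous_on UNIV f'')"

definition strongly_convex :: "real \<Rightarrow> ('a::euclidean_space \<Rightarrow> real) \<Rightarrow> bool" where
  "strongly_convex \<sigma> f \<longleftrightarrow>
    (\<forall>x y t. 0 \<le> t \<and> t \<le> 1 \<longrightarrow>
       f ((1 - t) *\<^sub>R x + t *\<^sub>R y)
         \<le> (1 - t) * f x + t * f y - \<sigma> / 2 * t * (1 - t) * (norm (x - y))\<^sup>2)"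

definition smooth_grad :: "real \<Rightarrow> ('a::euclidean_space \<Rightarrow> real) \<Rightarrow> bool" where
  "smooth_grad \<beta> f \<longleftrightarrow> \<beta>-lipschitz_on UNIV (grad f)"

definition prox_obj :: "real \<Rightarrow> ('a::euclidean_space \<Rightarrow> real) \<Rightarrow> 'a \<Rightarrow> 'a \<Rightarrow> real" where
  "prox_obj \<gamma> f z x = \<gamma> * f x + 1 / 2 * (norm (x - z))\<^sup>2"

definition prox :: "real \<Rightarrow> ('a::euclidean_space \<Rightarrow> real) \<Rightarrow> 'a \<Rightarrow> 'a" where
  "prox \<gamma> f z = arg_min (prox_obj \<gamma> f z) (\<lambda>_. True)"

definition prox_resid :: "real \<Rightarrow> ('a::euclidean_space \<Rightarrow> real) \<Rightarrow> 'a \<Rightarrow> 'a \<Rightarrow> 'a" where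
  "prox_resid \<gamma> f z x = \<gamma> *\<^sub>R grad f x + x - z"

lemma grad_prox_obj:
  assumes "GDERIV f x :> D"
  shows "grad (prox_obj \<gamma> f z) x = prox_resid \<gamma> f z x"
proof (rule grad_eqI)
  have "(f has_derivative (\<lambda>h. h \<bullet> D)) (at x)"
    using assms by (simp add: gderiv_def)
  then have "((\<lambda>x. \<gamma> * f x + 1 / 2 * ((x - z) \<bullet> (x - z))) has_derivative
      (\<lambda>h. h \<bullet> (\<gamma> *\<^sub>R D + x - z))) (at x)"
    by (auto intro!: derivative_eq_intros
        simp: fun_eq_iff algebra_simps inner_commute inner_diff_right inner_add_right)
  then show "GDERIV (prox_obj \<gamma> f z) x :> prox_resid \<gamma> f z x"
    by (simp add: gderiv_def prox_obj_def[abs_def] prox_resid_def grad_eqI[OF assms]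
        power2_norm_eq_inner)
qed

definition outer :: "'a::euclidean_space \<Rightarrow> 'a \<Rightarrow> 'a \<Rightarrow>\<^sub>L 'a" where
  "outer a b = Blinfun (\<lambda>h. (b \<bullet> h) *\<^sub>R a)"

lemma outer_apply [simp]: "blinfun_apply (outer a b) h = (b \<bullet> h) *\<^sub>R a"
  unfolding outer_def
  by (subst bounded_linear_Blinfun_apply) (auto intro!: bounded_linear_intros)

definition transpose_op :: "('a::euclidean_space \<Rightarrow>\<^sub>L 'a) \<Rightarrow> 'a \<Rightarrow>\<^sub>L 'a" where
  "transpose_op A = Blinfun (adjoint (blinfun_apply A))"

lemma transpose_op_apply: "blinfun_apply (transpose_op A) = adjoint (blinfun_apply A)"
  unfolding transpose_op_def
  by (intro bounded_linear_Blinfun_apply linear_conv_bounded_linear[THEN iffD1]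
      adjoint_linear blinfun.bounded_linear_right[THEN bounded_linear.linear])

text \<open>Only used for self-adjoint operators.\<close>

definition loewner_le :: "('a::euclidean_space \<Rightarrow>\<^sub>L 'a) \<Rightarrow> ('a \<Rightarrow>\<^sub>L 'a) \<Rightarrow> bool" where
  "loewner_le A B \<longleftrightarrow> (\<forall>h. h \<bullet> blinfun_apply A h \<le> h \<bullet> blinfun_apply B h)"

datatype update_type = BFGS | SR1

record inner_params =
  pred_steps :: nat         \<comment> \<open>\<open>K\<close>\<close>
  grad_steps :: nat         \<comment> \<open>\<open>b\<close>\<close>
  c_A :: real
  theta_Q :: real
  nu_qn :: real
  eta_max :: real           \<comment> \<open>the step cap, eta bar\<close>
  eps_sr1 :: real
  h_lo :: real              \<comment> \<open>lower scaling and spectral bound, h underlined\<close>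
  h_hi :: real              \<comment> \<open>upper scaling and spectral bound, h overlined\<close>
  vartheta0 :: real
  upd_type :: update_type

definition valid_params :: "inner_params \<Rightarrow> bool" where
  "valid_params P \<longleftrightarrow>
     1 \<le> grad_steps P \<and>
     0 < c_A P \<and> c_A P < 1 / 2 \<and>
     0 < theta_Q P \<and> theta_Q P < 1 \<and>
     0 < nu_qn P \<and> nu_qn P < 2 \<and>
     0 < eta_max P \<and> eta_max P \<le> 1 \<and>
     0 < eps_sr1 P \<and> eps_sr1 P < 1 \<and>
     0 < h_lo P \<and> h_lo P \<le> h_hi P \<and>
     h_lo P \<le> vartheta0 P \<and> vartheta0 P \<le> h_hi P"

text \<open>A memory lists its pairs in chronological order, so the newest pair is the last one.\<close>

type_synonym 'a memory = "('a \<times> 'a) list"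

definition secant_memory ::
  "real \<Rightarrow> ('a::euclidean_space \<Rightarrow> real) \<Rightarrow> 'a memory \<Rightarrow> bool" where
  "secant_memory \<gamma> f M \<longleftrightarrow>
     (\<forall>(s, q) \<in> set M. s \<noteq> 0 \<and>
        (\<exists>u v. s = v - u \<and> q = \<gamma> *\<^sub>R (grad f v - grad f u) + s))"

definition init_scale :: "inner_params \<Rightarrow> 'a::euclidean_space memory \<Rightarrow> real" where
  "init_scale P M =
     (if M = [] then vartheta0 P
      else (case last M of (s, q) \<Rightarrow>
        min (h_hi P) (max (h_lo P) ((s \<bullet> q) / (norm q)\<^sup>2))))"

text \<open>The updates act on the pair \<open>(H, B)\<close> of the inverse metric and the metric.\<close>

definition bfgs_update ::
  "'a::euclidean_space \<times> 'a \<Rightarrow> ('a \<Rightarrow>\<^sub>L 'a) \<times> ('a \<Rightarrow>\<^sub>L 'a) \<Rightarrow> ('a \<Rightarrow>\<^sub>L 'a) \<times> ('a \<Rightarrow>\<^sub>L 'a)" where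
  "bfgs_update = (\<lambda>(s, y) (H, B).
     let \<omega> = 1 / (s \<bullet> y);
         V = id_blinfun - \<omega> *\<^sub>R outer s y
     in ((V o\<^sub>L H o\<^sub>L transpose_op V) + \<omega> *\<^sub>R outer s s,
         B - (1 / (s \<bullet> blinfun_apply B s)) *\<^sub>R (B o\<^sub>L outer s s o\<^sub>L B)
           + (1 / (s \<bullet> y)) *\<^sub>R outer y y))"

definition sr1_update ::
  "inner_params \<Rightarrow> 'a::euclidean_space \<times> 'a \<Rightarrow> ('a \<Rightarrow>\<^sub>L 'a) \<times> ('a \<Rightarrow>\<^sub>L 'a)
     \<Rightarrow> ('a \<Rightarrow>\<^sub>L 'a) \<times> ('a \<Rightarrow>\<^sub>L 'a)" where
  "sr1_update P = (\<lambda>(s, y) (H, B).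
     let u = s - blinfun_apply H y;
         v = y - blinfun_apply B s;
         H' = H + (1 / (u \<bullet> y)) *\<^sub>R outer u u;
         B' = B + (1 / (v \<bullet> s)) *\<^sub>R outer v v
     in if u \<bullet> y \<noteq> 0 \<and> v \<bullet> s \<noteq> 0 \<and>
           \<bar>u \<bullet> y\<bar> \<ge> eps_sr1 P * norm u * norm y \<and>
           loewner_le (h_lo P *\<^sub>R id_blinfun) H' \<and> loewner_le H' (h_hi P *\<^sub>R id_blinfun) \<and>
           loewner_le (inverse (h_hi P) *\<^sub>R id_blinfun) B' \<and>
           loewner_le B' (inverse (h_lo P) *\<^sub>R id_blinfun)
        then (H', B') else (H, B))"

definition qn_update ::
  "inner_params \<Rightarrow> 'a::euclidean_space \<times> 'a \<Rightarrow> ('a \<Rightarrow>\<^sub>L 'a) \<times> ('a \<Rightarrow>\<^sub>L 'a)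
     \<Rightarrow> ('a \<Rightarrow>\<^sub>L 'a) \<times> ('a \<Rightarrow>\<^sub>L 'a)" where
  "qn_update P = (case upd_type P of BFGS \<Rightarrow> bfgs_update | SR1 \<Rightarrow> sr1_update P)"

definition build_metric ::
  "inner_params \<Rightarrow> 'a::euclidean_space memory \<Rightarrow> ('a \<Rightarrow>\<^sub>L 'a) \<times> ('a \<Rightarrow>\<^sub>L 'a)" where
  "build_metric P M =
     fold (qn_update P) M
       (init_scale P M *\<^sub>R id_blinfun, inverse (init_scale P M) *\<^sub>R id_blinfun)"

definition pred_stepsize ::
  "inner_params \<Rightarrow> ('a::euclidean_space \<Rightarrow>\<^sub>L 'a) \<Rightarrow> 'a \<Rightarrow> 'a \<Rightarrow> real" where
  "pred_stepsize P B r d =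
     (if d \<noteq> 0 \<and> r \<bullet> d < 0 \<and> d \<bullet> blinfun_apply B d > 0
      then min (eta_max P) (nu_qn P * (- (r \<bullet> d) / (d \<bullet> blinfun_apply B d)))
      else 0)"

text \<open>
  Pseudo-states: pairs of a pseudo-iterate and its model residual. After a zero step the
  state is a fixed point of the recursion, so no explicit stopping flag is needed.
\<close>

primrec predictor ::
  "inner_params \<Rightarrow> ('a::euclidean_space \<Rightarrow>\<^sub>L 'a) \<Rightarrow> ('a \<Rightarrow>\<^sub>L 'a) \<Rightarrow> 'a \<Rightarrow> 'a \<Rightarrow> nat \<Rightarrow> 'a \<times> 'a" where
  "predictor P H B a r 0 = (a, r)"
| "predictor P H B a r (Suc j) =
     (case predictor P H B a r j of (x, t) \<Rightarrow>
        let d = - blinfun_apply H t;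
            x' = x + pred_stepsize P B t d *\<^sub>R d
        in (x', t + blinfun_apply B (x' - x)))"

definition candidate ::
  "inner_params \<Rightarrow> real \<Rightarrow> ('a::euclidean_space \<Rightarrow> real) \<Rightarrow> 'a memory \<Rightarrow> 'a \<Rightarrow> 'a \<Rightarrow> 'a" where
  "candidate P \<gamma> f M z a =
     (case build_metric P M of (H, B) \<Rightarrow>
        fst (predictor P H B a (prox_resid \<gamma> f z a) (pred_steps P)))"

definition accepts ::
  "inner_params \<Rightarrow> real \<Rightarrow> real \<Rightarrow> real \<Rightarrow> ('a::euclidean_space \<Rightarrow> real) \<Rightarrow> 'a \<Rightarrow> 'a \<Rightarrow> 'a \<Rightarrow> bool" where
  "accepts P m L \<gamma> f z a x \<longleftrightarrow>
     (let r = prox_resid \<gamma> f z a in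
        r \<bullet> (x - a) < 0 \<and>
        prox_obj \<gamma> f z x \<le> prox_obj \<gamma> f z a + c_A P * (r \<bullet> (x - a)) \<and>
        norm (prox_resid \<gamma> f z x) \<le> m / L * theta_Q P * norm r)"

definition grad_step ::
  "real \<Rightarrow> real \<Rightarrow> real \<Rightarrow> ('a::euclidean_space \<Rightarrow> real) \<Rightarrow> 'a \<Rightarrow> 'a \<Rightarrow> 'a" where
  "grad_step m L \<gamma> f z u = u - (2 / (m + L)) *\<^sub>R prox_resid \<gamma> f z u"

definition inner_routine ::
  "inner_params \<Rightarrow> real \<Rightarrow> real \<Rightarrow> real \<Rightarrow> ('a::euclidean_space \<Rightarrow> real)
     \<Rightarrow> 'a memory \<Rightarrow> 'a \<Rightarrow> 'a \<Rightarrow> 'a" where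
  "inner_routine P m L \<gamma> f M z a =
     (let x = candidate P \<gamma> f M z a
      in if accepts P m L \<gamma> f z a x then x
         else (grad_step m L \<gamma> f z ^^ grad_steps P) a)"

end

theory Submission
  imports Defs
begin

text \<open>
  Write \<open>\<phi>\<close> for the proximal objective and \<open>r\<close> for its gradient. Strong convexity and smoothness
  bound \<open>\<phi>\<close> from below and above by quadratics of curvature \<open>m\<close> and \<open>L\<close>, which gives
  \<open>\<langle>\<Delta>r - m \<Delta>x, \<Delta>r - L \<Delta>x\<rangle> \<le> 0\<close> for increments. It follows that
  \<open>m \<parallel>\<Delta>x\<parallel> \<le> \<parallel>\<Delta>r\<parallel> \<le> L \<parallel>\<Delta>x\<parallel>\<close> and that the gradient step of length \<open>2 / (m + L)\<close> contracts by
  \<open>(L - m) / (L + m)\<close>. The fixed point of this contraction is the proximal point, where \<open>r = 0\<close>.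
  The third acceptance test then bounds the error of an accepted candidate by \<open>\<theta>\<^sub>Q\<close>, however the
  candidate was computed, and \<open>b\<close> gradient steps give \<open>\<theta>\<^sub>G ^ b\<close> otherwise.
\<close>

section \<open>First-order bounds from strong convexity and smoothness\<close>

lemma twice_continuously_differentiable_gderiv:
  assumes "twice_continuously_differentiable f"
  shows "GDERIV f x :> grad f x"
proof -
  obtain f' where f': "(f has_derivative blinfun_apply (f' x)) (at x)"
    using assms unfolding twice_continuously_differentiable_def by blast
  have "linear (blinfun_apply (f' x))"
    using f' by (rule has_derivative_linear)
  \<comment> \<open>The adjoint of a linear functional, evaluated at 1, is its Riesz representer,
    hence the gradient vector.\<close>
  then have "blinfun_apply (f' x) = (\<lambda>h. h \<bullet> adjoint (blinfun_apply (f' x)) 1)"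
    by (simp add: fun_eq_iff adjoint_works)
  with f' have "GDERIV f x :> adjoint (blinfun_apply (f' x)) 1"
    by (simp add: gderiv_def)
  then show ?thesis
    by (simp add: grad_eqI)
qed

lemma gderiv_along_line:
  assumes "GDERIV f (x + t *\<^sub>R d) :> D"
  shows "((\<lambda>t. f (x + t *\<^sub>R d)) has_real_derivative D \<bullet> d) (at t)"
proof -
  have "((\<lambda>t. x + t *\<^sub>R d) has_derivative (\<lambda>h. h *\<^sub>R d)) (at t)"
    by (auto intro!: derivative_eq_intros)
  moreover have "(f has_derivative (\<lambda>h. h \<bullet> D)) (at (x + t *\<^sub>R d))"
    using assms by (simp add: gderiv_def)
  ultimately have "((\<lambda>t. f (x + t *\<^sub>R d)) has_derivative (\<lambda>h. (h *\<^sub>R d) \<bullet> D)) (at t)"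
    by (rule has_derivative_compose)
  then show ?thesis
    by (simp add: has_field_derivative_def inner_commute mult.commute[of _ "D \<bullet> d"] fun_eq_iff)
qed

text \<open>Strong convexity on the segment from \<open>x\<close> to \<open>y\<close>, divided by
  \<open>t > 0\<close>, bounds the difference quotient at \<open>x\<close>. Letting \<open>t\<close>
  tend to 0 from the right turns the quotient into the directional derivative and the factor
  \<open>1 - t\<close> into 1.\<close>

lemma strongly_convex_lower_bound:
  assumes "strongly_convex \<sigma> f" and "GDERIV f x :> D"
  shows "f x + D \<bullet> (y - x) + \<sigma> / 2 * (norm (y - x))\<^sup>2 \<le> f y"
proof -
  define n where "n = (norm (y - x))\<^sup>2"
  let ?q = "\<lambda>t. (f (x + t *\<^sub>R (y - x)) - f x) / t"
  have "((\<lambda>t. f (x + t *\<^sub>R (y - x))) has_real_derivative D \<bullet> (y - x)) (at 0)"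
    using gderiv_along_line[of f x 0 "y - x" D] assms(2) by simp
  then have "(?q \<longlongrightarrow> D \<bullet> (y - x)) (at 0)"
    by (simp add: has_field_derivative_iff)
  then have q: "(?q \<longlongrightarrow> D \<bullet> (y - x)) (at_right 0)"
    by (rule filterlim_mono) (auto simp: at_within_le_at)
  have "((\<lambda>t. f y - f x - \<sigma> / 2 * (1 - t) * n) \<longlongrightarrow> f y - f x - \<sigma> / 2 * (1 - 0) * n) (at_right 0)"
    by (intro tendsto_intros)
  moreover have "\<forall>\<^sub>F t in at_right 0. ?q t \<le> f y - f x - \<sigma> / 2 * (1 - t) * n"
    unfolding eventually_at_right_field
  proof (intro exI[of _ 1] conjI allI impI)
    fix t :: real assume t: "0 < t" "t < 1"
    have "f ((1 - t) *\<^sub>R x + t *\<^sub>R y) \<le> (1 - t) * f x + t * f y - \<sigma> / 2 * t * (1 - t) * n"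
      using assms(1) t unfolding strongly_convex_def n_def
      by (simp add: norm_minus_commute)
    moreover have "(1 - t) *\<^sub>R x + t *\<^sub>R y = x + t *\<^sub>R (y - x)"
      by (simp add: algebra_simps)
    ultimately have "f (x + t *\<^sub>R (y - x)) - f x \<le> (f y - f x - \<sigma> / 2 * (1 - t) * n) * t"
      by (simp add: algebra_simps)
    with t show "?q t \<le> f y - f x - \<sigma> / 2 * (1 - t) * n"
      by (simp add: pos_divide_le_eq)
  qed simp
  ultimately have "D \<bullet> (y - x) \<le> f y - f x - \<sigma> / 2 * (1 - 0) * n"
    using q by (intro tendsto_le[of "at_right 0"]) auto
  then show ?thesis
    by (simp add: n_def)
qed

text \<open>Moving the linear and quadratic terms to the left along the segment gives a function
  \<open>h\<close> whose derivative is nonpositive by Cauchy-Schwarz and the Lipschitz condition.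
  Monotonicity of \<open>h\<close> replaces integration of the gradient.\<close>

lemma lipschitz_gradient_upper_bound:
  assumes grad: "\<And>x. GDERIV f x :> g x" and lip: "\<beta>-lipschitz_on UNIV g"
  shows "f y \<le> f x + g x \<bullet> (y - x) + \<beta> / 2 * (norm (y - x))\<^sup>2"
proof -
  define d where "d = y - x"
  define h where "h t = f (x + t *\<^sub>R d) - t * (g x \<bullet> d) - \<beta> / 2 * (norm d)\<^sup>2 * t\<^sup>2" for t
  have "h 1 \<le> h 0"
  proof (rule DERIV_nonpos_imp_nonincreasing[of 0 1 h])
    fix t :: real assume t: "0 \<le> t" "t \<le> 1"
    let ?h' = "g (x + t *\<^sub>R d) \<bullet> d - g x \<bullet> d - \<beta> * (norm d)\<^sup>2 * t"
    have "(h has_real_derivative ?h') (at t)"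
      unfolding h_def
      by (rule derivative_eq_intros gderiv_along_line[OF grad] refl | simp)+
    moreover have "(g (x + t *\<^sub>R d) - g x) \<bullet> d \<le> norm (g (x + t *\<^sub>R d) - g x) * norm d"
      by (rule norm_cauchy_schwarz)
    moreover have "norm (g (x + t *\<^sub>R d) - g x) \<le> \<beta> * (t * norm d)"
      using lipschitz_onD[OF lip, of "x + t *\<^sub>R d" x] t by (simp add: dist_norm)
    then have "norm (g (x + t *\<^sub>R d) - g x) * norm d \<le> \<beta> * (t * norm d) * norm d"
      by (intro mult_right_mono) auto
    ultimately show "\<exists>z. (h has_real_derivative z) (at t) \<and> z \<le> 0"
      by (intro exI[of _ ?h']) (simp add: inner_diff_left power2_eq_square algebra_simps)
  qed simp
  then show ?thesis
    by (simp add: h_def d_def)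
qed

section \<open>Consequences of two-sided quadratic bounds\<close>

locale quadratically_bounded =
  fixes \<phi> :: "'a::euclidean_space \<Rightarrow> real" and r :: "'a \<Rightarrow> 'a" and m L :: real
  assumes lower: "\<phi> x + r x \<bullet> (y - x) + m / 2 * (norm (y - x))\<^sup>2 \<le> \<phi> y"
    and upper: "\<phi> y \<le> \<phi> x + r x \<bullet> (y - x) + L / 2 * (norm (y - x))\<^sup>2"
    and m_pos: "0 < m" and m_le_L: "m \<le> L"
begin

text \<open>
  Compare both bounds at the point \<open>y - t *\<^sub>R e\<close>, a gradient step from \<open>y\<close> for the function
  \<open>\<phi> - m/2 \<parallel>\<cdot>\<parallel>\<^sup>2 - \<langle>r x - m x, \<cdot>\<rangle>\<close>, which is minimal at \<open>x\<close>.
\<close>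

lemma trial_point_bound:
  fixes x y :: 'a and t :: real
  defines "e \<equiv> r y - r x - m *\<^sub>R (y - x)"
  shows "\<phi> x - \<phi> y + r x \<bullet> (y - x) + m / 2 * (norm (y - x))\<^sup>2
      + t * (norm e)\<^sup>2 - (L - m) / 2 * t\<^sup>2 * (norm e)\<^sup>2 \<le> 0"
proof -
  define w where "w = y - x"
  have "\<phi> x + r x \<bullet> (w - t *\<^sub>R e) + m / 2 * (norm (w - t *\<^sub>R e))\<^sup>2
      \<le> \<phi> y + r y \<bullet> (- (t *\<^sub>R e)) + L / 2 * (norm (t *\<^sub>R e))\<^sup>2"
    using lower[of x "y - t *\<^sub>R e"] upper[of "y - t *\<^sub>R e" y] by (simp add: w_def algebra_simps)
  moreover have "(norm (w - t *\<^sub>R e))\<^sup>2 = (norm w)\<^sup>2 - 2 * t * (w \<bullet> e) + t\<^sup>2 * (norm e)\<^sup>2"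
    unfolding power2_norm_eq_inner
    by (simp add: power2_eq_square[of t] inner_commute algebra_simps)
  ultimately have "\<phi> x + (r x \<bullet> w - t * (r x \<bullet> e))
      + m / 2 * ((norm w)\<^sup>2 - 2 * t * (w \<bullet> e) + t\<^sup>2 * (norm e)\<^sup>2)
      \<le> \<phi> y - t * (r y \<bullet> e) + L / 2 * (t\<^sup>2 * (norm e)\<^sup>2)"
    by (simp add: inner_diff_right power_mult_distrib)
  \<comment> \<open>Unfolding \<open>e\<close> in one factor only shows that the terms linear in
    \<open>t\<close> add up to \<open>t * (norm e)\<^sup>2\<close>.\<close>
  moreover have "(norm e)\<^sup>2 = r y \<bullet> e - r x \<bullet> e - m * (w \<bullet> e)"
    unfolding power2_norm_eq_inner by (subst (1) e_def) (simp add: inner_diff_left w_def)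
  then have "t * (norm e)\<^sup>2 = t * (r y \<bullet> e) - t * (r x \<bullet> e) - t * (m * (w \<bullet> e))"
    by (simp only: right_diff_distrib)
  ultimately show ?thesis
    unfolding w_def[symmetric] by (simp add: field_simps)
qed

text \<open>Adding the trial point bounds for \<open>(x, y)\<close> and \<open>(y, x)\<close>
  cancels the values of \<open>\<phi>\<close> and leaves a quadratic in \<open>t\<close> bounded by
  \<open>e \<bullet> w\<close>. Choosing the best \<open>t\<close> gives the claim.\<close>

lemma cocoercive:
  "(r x - r y - m *\<^sub>R (x - y)) \<bullet> (r x - r y - L *\<^sub>R (x - y)) \<le> 0"
proof -
  define w where "w = y - x"
  define e where "e = r y - r x - m *\<^sub>R w"
  have e': "(norm (r x - r y - m *\<^sub>R (x - y)))\<^sup>2 = (norm e)\<^sup>2"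
  proof -
    have "r x - r y - m *\<^sub>R (x - y) = - e"
      by (simp add: e_def w_def algebra_simps)
    then show ?thesis by simp
  qed
  have "r x \<bullet> (y - x) + r y \<bullet> (x - y) = - (e \<bullet> w) - m * (norm w)\<^sup>2"
    by (simp add: e_def w_def power2_norm_eq_inner algebra_simps inner_commute)
  then have bound: "2 * t * (norm e)\<^sup>2 - (L - m) * t\<^sup>2 * (norm e)\<^sup>2 \<le> e \<bullet> w" for t
    using trial_point_bound[of x y t] trial_point_bound[of y x t]
    unfolding e' by (simp add: e_def w_def norm_minus_commute field_simps)
  have "(norm e)\<^sup>2 \<le> (L - m) * (e \<bullet> w)"
  proof (cases "m = L")
    case True
    \<comment> \<open>Without a quadratic term the bound is linear in \<open>t\<close>. The witness
      below makes its left side \<open>\<bar>e \<bullet> w\<bar> + 1\<close>, which is too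
      large.\<close>
    have "e = 0"
    proof (rule ccontr)
      assume "e \<noteq> 0"
      with bound[of "(\<bar>e \<bullet> w\<bar> + 1) / (2 * (norm e)\<^sup>2)"] True show False
        by simp
    qed
    then show ?thesis by simp
  next
    case False
    with m_le_L have "0 < L - m" by simp
    \<comment> \<open>The value \<open>1 / (L - m)\<close> maximizes the left side of
      \<open>bound\<close> over \<open>t\<close>.\<close>
    then have "2 * (1 / (L - m)) * (norm e)\<^sup>2 - (L - m) * (1 / (L - m))\<^sup>2 * (norm e)\<^sup>2
        = (norm e)\<^sup>2 / (L - m)"
      by (simp add: power2_eq_square)
    with bound[of "1 / (L - m)"] \<open>0 < L - m\<close> show ?thesis
      by (simp add: pos_divide_le_eq mult.commute)
  qed
  then have "e \<bullet> (e - (L - m) *\<^sub>R w) \<le> 0"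
    by (simp add: power2_norm_eq_inner inner_diff_right)
  moreover have "r x - r y - m *\<^sub>R (x - y) = - e"
    and "r x - r y - L *\<^sub>R (x - y) = - (e - (L - m) *\<^sub>R w)"
    by (simp_all add: e_def w_def algebra_simps)
  ultimately show ?thesis
    by (simp only: inner_minus_left inner_minus_right minus_minus)
qed

lemma cocoercive_expanded:
  "(norm (r x - r y))\<^sup>2 + m * L * (norm (x - y))\<^sup>2 \<le> (m + L) * ((r x - r y) \<bullet> (x - y))"
  using cocoercive[of x y]
  unfolding power2_norm_eq_inner inner_diff_left[of "r x - r y" "m *\<^sub>R (x - y)"]
    inner_diff_right[of _ "r x - r y" "L *\<^sub>R (x - y)"]
  by (simp add: inner_commute[of "x - y" "r x - r y"] distrib_right mult_ac)

text \<open>By Cauchy-Schwarz, \<open>cocoercive_expanded\<close> becomes a quadratic inequality in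
  \<open>norm (r x - r y)\<close> with roots \<open>m * norm (x - y)\<close> and
  \<open>L * norm (x - y)\<close>, so the norm lies between them.\<close>

lemma gradient_bounds:
  shows "m * norm (x - y) \<le> norm (r x - r y)" and "norm (r x - r y) \<le> L * norm (x - y)"
proof -
  let ?c = "norm (r x - r y)" and ?d = "norm (x - y)"
  have "(m + L) * ((r x - r y) \<bullet> (x - y)) \<le> (m + L) * (?c * ?d)"
    using m_pos m_le_L by (intro mult_left_mono norm_cauchy_schwarz) auto
  with cocoercive_expanded[of x y] have "(?c - m * ?d) * (?c - L * ?d) \<le> 0"
    by (simp add: algebra_simps power2_eq_square)
  moreover have "m * ?d \<le> L * ?d"
    using m_le_L by (intro mult_right_mono) auto
  ultimately show "m * ?d \<le> ?c" "?c \<le> L * ?d"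
    by (auto simp: mult_le_0_iff)
qed

text \<open>With \<tau> = 2 / (m + L), the cross term of the expanded square is exactly
  \<open>\<tau>\<^sup>2 * ((m + L) * (D \<bullet> w))\<close>, so \<open>cocoercive_expanded\<close>
  absorbs \<open>\<tau>\<^sup>2 * (norm D)\<^sup>2\<close> and leaves a multiple of
  \<open>(norm w)\<^sup>2\<close>.\<close>

lemma gradient_step_contraction:
  "norm ((x - (2 / (m + L)) *\<^sub>R r x) - (y - (2 / (m + L)) *\<^sub>R r y))
    \<le> (L - m) / (L + m) * norm (x - y)"
proof (rule power2_le_imp_le)
  define D w \<tau> where "D = r x - r y" and "w = x - y" and "\<tau> = 2 / (m + L)"
  have pos: "0 < m + L" using m_pos m_le_L by simp
  have "(x - \<tau> *\<^sub>R r x) - (y - \<tau> *\<^sub>R r y) = w - \<tau> *\<^sub>R D"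
    by (simp add: D_def w_def algebra_simps)
  moreover have "(norm (w - \<tau> *\<^sub>R D))\<^sup>2
      = (norm w)\<^sup>2 - 2 * \<tau> * (D \<bullet> w) + \<tau>\<^sup>2 * (norm D)\<^sup>2"
    unfolding power2_norm_eq_inner
    by (simp add: power2_eq_square[of \<tau>] inner_commute algebra_simps)
  ultimately have "(norm ((x - \<tau> *\<^sub>R r x) - (y - \<tau> *\<^sub>R r y)))\<^sup>2
      = (norm w)\<^sup>2 - 2 * \<tau> * (D \<bullet> w) + \<tau>\<^sup>2 * (norm D)\<^sup>2"
    by (simp only:)
  also have "2 * \<tau> * (D \<bullet> w) = \<tau>\<^sup>2 * ((m + L) * (D \<bullet> w))"
    using pos by (simp add: \<tau>_def power2_eq_square)
  also have "(norm w)\<^sup>2 - \<tau>\<^sup>2 * ((m + L) * (D \<bullet> w)) + \<tau>\<^sup>2 * (norm D)\<^sup>2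
      \<le> (norm w)\<^sup>2 - \<tau>\<^sup>2 * (m * L * (norm w)\<^sup>2)"
    using mult_left_mono[OF cocoercive_expanded[of x y], of "\<tau>\<^sup>2"]
    unfolding D_def w_def by (simp add: algebra_simps)
  also have "\<dots> = ((L - m) / (L + m) * norm w)\<^sup>2"
  proof -
    have "1 - \<tau>\<^sup>2 * (m * L) = ((m + L)\<^sup>2 - 4 * (m * L)) / (m + L)\<^sup>2"
      using pos by (simp add: \<tau>_def power_divide diff_divide_distrib)
    also have "(m + L)\<^sup>2 - 4 * (m * L) = (L - m)\<^sup>2"
      by (simp add: power2_eq_square algebra_simps)
    finally have *: "1 - \<tau>\<^sup>2 * (m * L) = ((L - m) / (L + m))\<^sup>2"
      by (simp add: power_divide add.commute)
    show ?thesis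
      unfolding power_mult_distrib *[symmetric] by (simp add: algebra_simps)
  qed
  finally show "(norm ((x - (2 / (m + L)) *\<^sub>R r x) - (y - (2 / (m + L)) *\<^sub>R r y)))\<^sup>2
      \<le> ((L - m) / (L + m) * norm (x - y))\<^sup>2"
    by (simp add: \<tau>_def w_def)
qed (use m_pos m_le_L in auto)

text \<open>Since \<open>arg_min\<close> is a choice operator, a minimizer must first be exhibited.
  Banach's fixed point theorem for the gradient step supplies a zero \<open>q\<close> of
  \<open>r\<close>, and the lower bound at \<open>q\<close> makes it the only minimizer.\<close>

lemma gradient_vanishes_at_arg_min: "r (arg_min \<phi> (\<lambda>_. True)) = 0"
proof -
  define T where "T x = x - (2 / (m + L)) *\<^sub>R r x" for x
  have pos: "0 < m + L" using m_pos m_le_L by simp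
  have "\<exists>!x. T x = x"
  proof (rule banach_fix_type)
    show "(L - m) / (L + m) < 1" "0 \<le> (L - m) / (L + m)"
      using m_pos m_le_L by simp_all
    show "\<forall>x y. dist (T x) (T y) \<le> (L - m) / (L + m) * dist x y"
      using gradient_step_contraction by (simp add: T_def dist_norm)
  qed
  then obtain q where "T q = q" by blast
  with pos have q: "r q = 0"
    by (simp add: T_def)
  have quad: "\<phi> q + m / 2 * (norm (y - q))\<^sup>2 \<le> \<phi> y" for y
    using lower[of q y] q by simp
  have "\<phi> q \<le> \<phi> y" for y
    using quad[of y] m_pos by (smt (verit) divide_pos_pos mult_nonneg_nonneg zero_le_power2)
  then have "\<phi> (arg_min \<phi> (\<lambda>_. True)) = \<phi> q"
    by (intro arg_min_equality) auto
  with quad[of "arg_min \<phi> (\<lambda>_. True)"] m_pos have "arg_min \<phi> (\<lambda>_. True) = q"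
    by (simp add: mult_le_0_iff)
  with q show ?thesis by simp
qed

end

section \<open>The proximal objective and the inner routine\<close>

lemma prox_obj_quadratically_bounded:
  assumes tcd: "twice_continuously_differentiable f"
    and sc: "strongly_convex \<sigma> f" and sm: "smooth_grad \<beta> f"
    and "0 < \<sigma>" "\<sigma> \<le> \<beta>" "0 < \<gamma>"
  shows "quadratically_bounded (prox_obj \<gamma> f z) (prox_resid \<gamma> f z) (1 + \<gamma> * \<sigma>) (1 + \<gamma> * \<beta>)"
proof
  note grad = twice_continuously_differentiable_gderiv[OF tcd]
  show "0 < 1 + \<gamma> * \<sigma>" "1 + \<gamma> * \<sigma> \<le> 1 + \<gamma> * \<beta>"
    using assms(4-6) by (simp_all add: add_pos_pos)
  fix x y
  \<comment> \<open>The proximal term equals its second-order expansion at \<open>x\<close>, with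
    curvature 1. This is the 1 in both constants.\<close>
  have sq: "(norm (y - z))\<^sup>2 = (norm (x - z))\<^sup>2 + 2 * ((x - z) \<bullet> (y - x)) + (norm (y - x))\<^sup>2"
    by (simp add: power2_norm_eq_inner algebra_simps inner_commute)
  have lin: "prox_resid \<gamma> f z x \<bullet> (y - x) = \<gamma> * (grad f x \<bullet> (y - x)) + (x - z) \<bullet> (y - x)"
    by (simp add: prox_resid_def add_diff_eq[symmetric] inner_add_left)
  have "\<gamma> * (f x + grad f x \<bullet> (y - x) + \<sigma> / 2 * (norm (y - x))\<^sup>2) \<le> \<gamma> * f y"
    using strongly_convex_lower_bound[OF sc grad] \<open>0 < \<gamma>\<close> by simp
  then show "prox_obj \<gamma> f z x + prox_resid \<gamma> f z x \<bullet> (y - x)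
      + (1 + \<gamma> * \<sigma>) / 2 * (norm (y - x))\<^sup>2 \<le> prox_obj \<gamma> f z y"
    unfolding prox_obj_def sq lin by (simp add: field_simps)
  have "\<gamma> * f y \<le> \<gamma> * (f x + grad f x \<bullet> (y - x) + \<beta> / 2 * (norm (y - x))\<^sup>2)"
    using lipschitz_gradient_upper_bound[OF grad sm[unfolded smooth_grad_def]] \<open>0 < \<gamma>\<close> by simp
  then show "prox_obj \<gamma> f z y \<le> prox_obj \<gamma> f z x + prox_resid \<gamma> f z x \<bullet> (y - x)
      + (1 + \<gamma> * \<beta>) / 2 * (norm (y - x))\<^sup>2"
    unfolding prox_obj_def sq lin by (simp add: field_simps)
qed

theorem lemma3p2:
  fixes f :: "'a::euclidean_space \<Rightarrow> real"
    and \<sigma> \<beta> \<gamma> m L \<theta>\<^sub>G \<theta> :: real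
    and P :: inner_params
    and M :: "'a memory"
    and z a x p :: 'a
  assumes "convex_on UNIV f"
    and "twice_continuously_differentiable f"
    and "strongly_convex \<sigma> f"
    and "smooth_grad \<beta> f"
    and "0 < \<sigma>" and "\<sigma> \<le> \<beta>"
    and "0 < \<gamma>"
    and "valid_params P"
    and "secant_memory \<gamma> f M"
    and "m = 1 + \<gamma> * \<sigma>"
    and "L = 1 + \<gamma> * \<beta>"
    and "\<theta>\<^sub>G = (L - m) / (L + m)"
    and "\<theta> = max (theta_Q P) (\<theta>\<^sub>G ^ grad_steps P)"
    and "p = prox \<gamma> f z"
    and "x = inner_routine P m L \<gamma> f M z a"
  shows "norm (x - p) \<le> \<theta> * norm (a - p)"
proof -
  interpret quadratically_bounded "prox_obj \<gamma> f z" "prox_resid \<gamma> f z" m L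
    using prox_obj_quadratically_bounded assms by blast
  have rp: "prox_resid \<gamma> f z p = 0"
    using gradient_vanishes_at_arg_min assms(14) by (simp add: prox_def)
  show ?thesis
  proof (cases "accepts P m L \<gamma> f z a (candidate P \<gamma> f M z a)")
    case True
    then have x: "x = candidate P \<gamma> f M z a"
      by (simp add: assms(15) inner_routine_def Let_def)
    have \<theta>\<^sub>Q: "0 < theta_Q P"
      using \<open>valid_params P\<close> by (simp add: valid_params_def)
    have "m * norm (x - p) \<le> norm (prox_resid \<gamma> f z x)"
      using gradient_bounds(1)[of x p] rp by simp
    also have "\<dots> \<le> m / L * theta_Q P * norm (prox_resid \<gamma> f z a)"
      using True by (simp add: x accepts_def Let_def)
    also have "\<dots> \<le> m / L * theta_Q P * (L * norm (a - p))"
      using gradient_bounds(2)[of a p] rp m_pos m_le_L \<theta>\<^sub>Q by (intro mult_left_mono) auto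
    \<comment> \<open>The factor \<open>m / L\<close> of the test cancels the loss in passing from
      distances to residuals and back.\<close>
    also have "\<dots> = m * (theta_Q P * norm (a - p))"
      using m_pos m_le_L by simp
    finally have "norm (x - p) \<le> theta_Q P * norm (a - p)"
      using m_pos by simp
    also have "\<dots> \<le> \<theta> * norm (a - p)"
      unfolding assms(13) by (intro mult_right_mono) auto
    finally show ?thesis .
  next
    case False
    have "0 \<le> \<theta>\<^sub>G"
      using m_pos m_le_L assms(12) by simp
    have "norm ((grad_step m L \<gamma> f z ^^ n) a - p) \<le> \<theta>\<^sub>G ^ n * norm (a - p)" for n
    proof (induction n)
      case (Suc n)
      let ?u = "(grad_step m L \<gamma> f z ^^ n) a"
      \<comment> \<open>As its residual vanishes, \<open>p\<close> is fixed by the gradient step, so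
        the contraction applies to the pair \<open>?u\<close>, \<open>p\<close>.\<close>
      have "norm (grad_step m L \<gamma> f z ?u - p) \<le> \<theta>\<^sub>G * norm (?u - p)"
        using gradient_step_contraction[of ?u p] rp by (simp add: grad_step_def assms(12))
      also have "\<dots> \<le> \<theta>\<^sub>G * (\<theta>\<^sub>G ^ n * norm (a - p))"
        using Suc \<open>0 \<le> \<theta>\<^sub>G\<close> by (rule mult_left_mono)
      finally show ?case by simp
    qed simp
    moreover have "x = (grad_step m L \<gamma> f z ^^ grad_steps P) a"
      using False by (simp add: assms(15) inner_routine_def Let_def)
    ultimately have "norm (x - p) \<le> \<theta>\<^sub>G ^ grad_steps P * norm (a - p)"
      by simp
    also have "\<dots> \<le> \<theta> * norm (a - p)"
      unfolding assms(13) by (intro mult_right_mono) auto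
    finally show ?thesis .
  qed
qed

end
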